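(* Let $ABC$ be an acute triangle in the Euclidean plane, and let rectangles $BCC_1B_2$, $CAA_1C_2$, and $ABB_1A_2$ be erected outside the triangle $ABC$. Suppose that $$\angle BC_1C + \angle CA_1A + \angle AB_1B = 180^\circ.$$ Then the lines $B_1C_2$, $C_1A_2$, and $A_1B_2$ are concurrent.
   Context: Each rectangle is named by its vertices in cyclic order; for example, $BCC_1B_2$ is the rectangle with consecutive vertices $B, C, C_1, B_2$, having the side $BC$ of the triangle as one of its sides. "Erected outside" means that each rectangle lies on the side of the corresponding triangle side opposite to the triangle (for example, the rectangle $BCC_1B_2$ lies on the opposite side of line $BC$ from $A$). Angles are ordinary undirected angles. Lines are concurrent if they pass through a common point. *)

theory Defs
  imports "HOL-Analysis.Analysis"
begin

(* The undirected angle PQR, with vertex Q, in radians. *)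
definition angle :: "real^2 \<Rightarrow> real^2 \<Rightarrow> real^2 \<Rightarrow> real" where
  "angle P Q R = arccos (((P - Q) \<bullet> (R - Q)) / (norm (P - Q) * norm (R - Q)))"

definition acute_triangle :: "real^2 \<Rightarrow> real^2 \<Rightarrow> real^2 \<Rightarrow> bool" where
  "acute_triangle A B C \<longleftrightarrow> \<not> collinear {A, B, C} \<and>
     angle B A C < pi / 2 \<and> angle A B C < pi / 2 \<and> angle A C B < pi / 2"

definition line_through :: "real^2 \<Rightarrow> real^2 \<Rightarrow> (real^2) set" where
  "line_through P Q = affine hull {P, Q}"

(* Nondegenerate, with the vertices P, Q, R, S in cyclic order: a parallelogram with a
   right angle at P. *)
definition rectangle :: "real^2 \<Rightarrow> real^2 \<Rightarrow> real^2 \<Rightarrow> real^2 \<Rightarrow> bool" where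
  "rectangle P Q R S \<longleftrightarrow>
     P \<noteq> Q \<and> P \<noteq> S \<and> R - Q = S - P \<and> orthogonal (Q - P) (S - P)"

definition opposite_sides :: "(real^2) set \<Rightarrow> real^2 \<Rightarrow> real^2 \<Rightarrow> bool" where
  "opposite_sides L X Y \<longleftrightarrow> X \<notin> L \<and> Y \<notin> L \<and> closed_segment X Y \<inter> L \<noteq> {}"

(* The rectangle PQRS is erected on the side PQ of the triangle with third vertex X.
   Only its side PQ lies on the line PQ; the rest of the region must be across from X. *)
definition rectangle_outside ::
    "real^2 \<Rightarrow> real^2 \<Rightarrow> real^2 \<Rightarrow> real^2 \<Rightarrow> real^2 \<Rightarrow> bool" where
  "rectangle_outside X P Q R S \<longleftrightarrow> rectangle P Q R S \<and>
     (\<forall>Y \<in> convex hull {P, Q, R, S} - line_through P Q.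
        opposite_sides (line_through P Q) X Y)"

definition concurrent :: "(real^2) set \<Rightarrow> (real^2) set \<Rightarrow> (real^2) set \<Rightarrow> bool" where
  "concurrent K L M \<longleftrightarrow> (\<exists>X. X \<in> K \<and> X \<in> L \<and> X \<in> M)"

end

theory Submission
  imports Defs
begin

text \<open>
  The circumcircles of the three rectangles pass through a common point \<open>X\<close>: their angle condition
  says that the angles under which \<open>X\<close> sees the sides add up to a full turn. Since \<open>AB\<^sub>1\<close> and
  \<open>AC\<^sub>2\<close> are diameters of two of these circles, \<open>B\<^sub>1X\<close> and \<open>C\<^sub>2X\<close> are both perpendicular to
  \<open>AX\<close>, so that \<open>X\<close> lies on the line \<open>B\<^sub>1C\<^sub>2\<close>; likewise for the other two lines. If \<open>p\<close>, \<open>q\<close>,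
  \<open>r\<close> are the ratios height to base of the rectangles on \<open>BC\<close>, \<open>CA\<close>, \<open>AB\<close>, the angle condition
  becomes \<open>pq + qr + rp = 1\<close>, and \<open>X\<close> has barycentric coordinates
  \<open>1/(cot A + p) : 1/(cot B + q) : 1/(cot C + r)\<close>. Giving \<open>p\<close>, \<open>q\<close>, \<open>r\<close> the sign of the
  orientation of \<open>ABC\<close> treats both orientations at once.
\<close>

section \<open>Determinants and incidence in the plane\<close>

definition perp :: "real^2 \<Rightarrow> real^2" where
  "perp v = vector [- v$2, v$1]"

definition cross2 :: "real^2 \<Rightarrow> real^2 \<Rightarrow> real" where
  "cross2 u v = u$1 * v$2 - u$2 * v$1"

lemma perp_nth [simp]: "perp v $ 1 = - v$2" "perp v $ 2 = v$1"
  by (simp_all add: perp_def)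

lemma inner_real2: "(u::real^2) \<bullet> v = u$1 * v$1 + u$2 * v$2"
  by (simp add: inner_vec_def sum_2)

lemma vec2_eq_iff: "(u::real^2) = v \<longleftrightarrow> u$1 = v$1 \<and> u$2 = v$2"
  by (simp add: vec_eq_iff forall_2)

lemma inner_perp_perp: "perp u \<bullet> perp v = u \<bullet> v"
  by (simp add: inner_real2)

lemma inner_perp: "u \<bullet> perp v = - cross2 u v" "perp v \<bullet> u = - cross2 u v"
  by (simp_all add: inner_real2 cross2_def)

lemma cross2_self [simp]: "cross2 u u = 0"
  by (simp add: cross2_def)

lemma cross2_commute: "cross2 v u = - cross2 u v"
  by (simp add: cross2_def)

lemma cross2_linear:
  "cross2 u (a *\<^sub>R v + b *\<^sub>R w) = a * cross2 u v + b * cross2 u w"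
  by (simp add: cross2_def algebra_simps)

lemma cross2_rotate: "cross2 (C - B) (A - B) = cross2 (B - A) (C - A)"
  by (simp add: cross2_def algebra_simps)

text \<open>Lagrange's identity in dimension two.\<close>

lemma inner_cross2_sq: "(u \<bullet> u) * (v \<bullet> v) = (u \<bullet> v)\<^sup>2 + (cross2 u v)\<^sup>2"
  by (simp add: inner_real2 cross2_def power2_eq_square algebra_simps)

lemma parallel_imp_multiple:
  assumes "u \<noteq> 0" "cross2 u v = 0"
  shows "v = ((u \<bullet> v) / (u \<bullet> u)) *\<^sub>R u"
proof -
  have "(u \<bullet> u) *\<^sub>R v = (u \<bullet> v) *\<^sub>R u"
    using assms(2) unfolding vec2_eq_iff cross2_def inner_real2
    by (auto simp: algebra_simps)
  moreover have "u \<bullet> u \<noteq> 0" using assms(1) by simp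
  ultimately show ?thesis
    by (simp add: vec2_eq_iff field_simps)
qed

lemma mem_line_through_iff:
  assumes "P \<noteq> Q"
  shows "X \<in> line_through P Q \<longleftrightarrow> cross2 (Q - P) (X - P) = 0"
proof
  assume "X \<in> line_through P Q"
  then obtain u v where "X = u *\<^sub>R P + v *\<^sub>R Q" "u + v = 1"
    unfolding line_through_def affine_hull_2 by auto
  moreover from this have "X - P = v *\<^sub>R (Q - P)"
    by (simp add: algebra_simps flip: scaleR_add_left)
  ultimately show "cross2 (Q - P) (X - P) = 0"
    by (simp add: cross2_def)
next
  assume "cross2 (Q - P) (X - P) = 0"
  then obtain t where "X - P = t *\<^sub>R (Q - P)"
    using parallel_imp_multiple[of "Q - P" "X - P"] assms by auto
  then have "X = (1 - t) *\<^sub>R P + t *\<^sub>R Q"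
    by (simp add: algebra_simps)
  then show "X \<in> line_through P Q"
    unfolding line_through_def affine_hull_2 by force
qed

text \<open>In the plane, the vectors perpendicular to a nonzero \<open>w\<close> form a single line
  through the origin.\<close>

lemma orthogonal_imp_parallel:
  assumes "w \<noteq> 0" "w \<bullet> u = 0" "w \<bullet> v = 0"
  shows "cross2 u v = 0"
proof -
  have "w$1 * cross2 u v = 0" "w$2 * cross2 u v = 0"
    using assms(2,3) unfolding cross2_def inner_real2 by algebra+
  then show ?thesis using assms(1) by (auto simp: vec2_eq_iff)
qed

lemma not_collinear_cross2:
  assumes "\<not> collinear {A, B, C}"
  shows "cross2 (B - A) (C - A) \<noteq> 0"
proof -
  have "A \<noteq> B" using assms by auto
  then show ?thesis
    using assms collinear_3_affine_hull[of A B C] mem_line_through_iff[of A B C]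
    by (simp add: line_through_def)
qed

section \<open>Acute angles and outer rectangles as sign conditions\<close>

lemma angle_acute_imp_inner_pos:
  assumes "angle P Q R < pi / 2"
  shows "0 < (P - Q) \<bullet> (R - Q)"
proof (rule ccontr)
  assume neg: "\<not> ?thesis"
  let ?y = "((P - Q) \<bullet> (R - Q)) / (norm (P - Q) * norm (R - Q))"
  have "?y \<le> 0" using neg by (simp add: divide_nonpos_nonneg)
  \<comment> \<open>Monotonicity of \<open>arccos\<close> is available only on [-1, 1].\<close>
  moreover have "- 1 \<le> ?y"
  proof -
    have "\<bar>?y\<bar> \<le> 1"
      using Cauchy_Schwarz_ineq2[of "P - Q" "R - Q"] by (auto simp: abs_mult divide_le_eq_1 zero_less_mult_iff)
    then show ?thesis by linarith
  qed
  ultimately have "arccos 0 \<le> arccos ?y" by (intro arccos_le_arccos) auto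
  then show False using assms by (simp add: angle_def)
qed

text \<open>Here \<open>p\<close> is the signed ratio of height to base. As \<open>perp\<close> is
  the counterclockwise quarter turn, \<open>- perp (Q - P)\<close> points away from \<open>X\<close>
  exactly when \<open>P\<close>, \<open>Q\<close>, \<open>X\<close> run counterclockwise, so
  \<open>p\<close> carries the sign of that orientation.\<close>

lemma rectangle_outside_param:
  assumes "rectangle_outside X P Q R S" "cross2 (Q - P) (X - P) \<noteq> 0"
  obtains p where "R = Q - p *\<^sub>R perp (Q - P)" "S = P - p *\<^sub>R perp (Q - P)"
    "0 < p * cross2 (Q - P) (X - P)"
proof -
  let ?c = "cross2 (Q - P) (X - P)"
  have rect: "P \<noteq> Q" "P \<noteq> S" "R - Q = S - P" "(Q - P) \<bullet> (S - P) = 0"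
    using assms(1) by (auto simp: rectangle_outside_def rectangle_def orthogonal_def)
  define N where "N = (Q - P) \<bullet> (Q - P)"
  have N: "0 < N" using rect(1) by (simp add: N_def)
  have "cross2 (perp (Q - P)) (S - P) = 0"
    using rect(4) by (simp add: cross2_def inner_real2 algebra_simps)
  moreover have "perp (Q - P) \<noteq> 0"
    using rect(1) by (auto simp: vec2_eq_iff)
  ultimately obtain t where t: "S - P = t *\<^sub>R perp (Q - P)"
    using parallel_imp_multiple by blast
  define p where "p = - t"
  have S: "S - P = - (p *\<^sub>R perp (Q - P))" using t by (simp add: p_def)
  have p0: "p \<noteq> 0" using S rect(2) by auto
  have cS: "cross2 (Q - P) (S - P) = - p * N"
    unfolding t N_def p_def by (simp add: cross2_def inner_real2 algebra_simps)
  \<comment> \<open>Testing the outside condition at the single vertex \<open>S\<close> already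
    fixes the sign of \<open>p\<close>.\<close>
  have "S \<notin> line_through P Q"
    using mem_line_through_iff[OF rect(1), of S] cS p0 N by auto
  moreover have "S \<in> convex hull {P, Q, R, S}" by (simp add: hull_inc)
  ultimately have "opposite_sides (line_through P Q) X S"
    using assms(1) by (auto simp: rectangle_outside_def)
  then obtain Y where Y: "Y \<in> closed_segment X S" "Y \<in> line_through P Q"
    by (auto simp: opposite_sides_def)
  then obtain s where s: "0 \<le> s" "s \<le> 1" "Y = (1 - s) *\<^sub>R X + s *\<^sub>R S"
    by (auto simp: closed_segment_def)
  have "Y - P = (1 - s) *\<^sub>R (X - P) + s *\<^sub>R (S - P)"
    using s(3) by (simp add: algebra_simps)
  \<comment> \<open>The linear map \<open>cross2 (Q - P)\<close> vanishes at \<open>Y - P\<close>,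
    so it takes opposite signs at \<open>X - P\<close> and \<open>S - P\<close>.\<close>
  then have eq: "(1 - s) * ?c = s * (p * N)"
    using Y(2) mem_line_through_iff[OF rect(1), of Y] cS by (simp add: cross2_linear)
  have "s \<noteq> 0" using eq assms(2) by auto
  moreover have "s \<noteq> 1" using eq p0 N by auto
  ultimately have "0 < s" "0 < 1 - s" using s by auto
  have "(1 - s) * (p * ?c) = s * N * p\<^sup>2"
    using eq by (simp add: power2_eq_square)
  moreover have "0 < s * N * p\<^sup>2" using \<open>0 < s\<close> N p0 by simp
  ultimately have "0 < p * ?c" using \<open>0 < 1 - s\<close> by (metis zero_less_mult_pos)
  moreover have "S = P - p *\<^sub>R perp (Q - P)" using S by (simp add: algebra_simps)
  moreover have "R = Q - p *\<^sub>R perp (Q - P)" using S rect(3) by (metis diff_add_cancel add.commute uminus_add_conv_diff)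
  ultimately show ?thesis using that by blast
qed

section \<open>The angle condition as a polynomial equation\<close>

text \<open>For nonzero \<open>p\<close>, the triangle \<open>P Q R\<close> has a right angle at
  \<open>Q\<close> and legs \<open>n\<close> and \<open>\<bar>p\<bar> * n\<close>, so the cotangent
  of its angle at \<open>R\<close> is \<open>\<bar>p\<bar>\<close>.\<close>

lemma angle_rectangle_diagonal:
  assumes "P \<noteq> Q" "R = Q - p *\<^sub>R perp (Q - P)"
  shows "angle P R Q = arccos (\<bar>p\<bar> / sqrt (1 + p\<^sup>2))"
proof -
  define n where "n = norm (Q - P)"
  have n: "0 < n" using assms(1) by (simp add: n_def)
  have nn: "(Q - P) \<bullet> (Q - P) = n\<^sup>2" by (simp add: n_def power2_norm_eq_inner)
  have PR: "P - R = p *\<^sub>R perp (Q - P) - (Q - P)" and QR: "Q - R = p *\<^sub>R perp (Q - P)"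
    by (simp_all add: assms(2))
  have "(P - R) \<bullet> (Q - R) = p\<^sup>2 * n\<^sup>2"
    using nn unfolding PR QR by (simp add: inner_real2 power2_eq_square algebra_simps) algebra
  moreover have "norm (Q - R) = \<bar>p\<bar> * n"
    unfolding QR norm_eq_sqrt_inner inner_scaleR_left inner_scaleR_right inner_perp_perp nn
    using n by (simp add: real_sqrt_mult flip: mult.assoc)
  moreover have "norm (P - R) = sqrt (1 + p\<^sup>2) * n"
  proof -
    have "(P - R) \<bullet> (P - R) = (1 + p\<^sup>2) * n\<^sup>2"
      using nn unfolding PR by (simp add: inner_real2 power2_eq_square algebra_simps) algebra
    then show ?thesis using n by (simp add: norm_eq_sqrt_inner real_sqrt_mult)
  qed
  ultimately have "angle P R Q = arccos (p\<^sup>2 * n\<^sup>2 / (sqrt (1 + p\<^sup>2) * n * (\<bar>p\<bar> * n)))"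
    by (simp add: angle_def)
  also have "p\<^sup>2 * n\<^sup>2 / (sqrt (1 + p\<^sup>2) * n * (\<bar>p\<bar> * n)) = \<bar>p\<bar> / sqrt (1 + p\<^sup>2)"
  \<comment> \<open>For \<open>p = 0\<close> the left side is 0 / 0, which is 0 by convention and
    agrees with the right side.\<close>
  proof (cases "p = 0")
    case False
    have "p\<^sup>2 * n\<^sup>2 = \<bar>p\<bar> * (n * (\<bar>p\<bar> * n))" by (simp add: power2_eq_square)
    then show ?thesis using n False by (simp add: mult.assoc)
  qed simp
  finally show ?thesis .
qed

text \<open>This is cot \<alpha> = |p|, kept free of division so that it can be substituted into the
  addition formulas.\<close>

lemma sin_cos_arccos_ratio:
  fixes p :: real
  defines "\<alpha> \<equiv> arccos (\<bar>p\<bar> / sqrt (1 + p\<^sup>2))"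
  shows "cos \<alpha> = \<bar>p\<bar> * sin \<alpha>" "sin \<alpha> \<noteq> 0"
proof -
  let ?s = "sqrt (1 + p\<^sup>2)"
  have s: "0 < ?s" "?s\<^sup>2 = 1 + p\<^sup>2" by (simp_all add: add_pos_nonneg)
  have le: "\<bar>p\<bar> / ?s \<le> 1"
    using s(1) by (simp add: field_simps real_le_rsqrt)
  have ge: "- 1 \<le> \<bar>p\<bar> / ?s" using s(1) by (smt (verit) divide_nonneg_pos abs_ge_zero)
  have "1 - (\<bar>p\<bar> / ?s)\<^sup>2 = (1 / ?s)\<^sup>2"
    using s by (simp add: power_divide divide_simps add_nonneg_eq_0_iff)
  then have sin: "sin \<alpha> = 1 / ?s"
    unfolding \<alpha>_def sin_arccos[OF ge le] using s(1) by (simp add: real_sqrt_divide)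
  then show "sin \<alpha> \<noteq> 0" using s(1) by simp
  show "cos \<alpha> = \<bar>p\<bar> * sin \<alpha>"
    unfolding sin by (simp add: \<alpha>_def cos_arccos[OF ge le])
qed

lemma cot_sum_eq_1:
  fixes \<alpha> \<beta> \<gamma> p q r :: real
  assumes "\<alpha> + \<beta> + \<gamma> = pi"
    and "cos \<alpha> = p * sin \<alpha>" "cos \<beta> = q * sin \<beta>" "cos \<gamma> = r * sin \<gamma>"
    and "sin \<alpha> \<noteq> 0" "sin \<beta> \<noteq> 0" "sin \<gamma> \<noteq> 0"
  shows "p * q + q * r + r * p = 1"
proof -
  have "sin (\<alpha> + \<beta> + \<gamma>) = sin \<alpha> * sin \<beta> * sin \<gamma> * (p * q + q * r + r * p - 1)"
    by (simp add: sin_add cos_add assms(2-4) algebra_simps)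
  then show ?thesis using assms(1,5-7) by simp
qed

section \<open>The common point\<close>

text \<open>Since \<open>x\<close> equals |D| (cot A + |p|), and similarly for \<open>y\<close> and
  \<open>z\<close>, the last hypothesis is the barycentric description of \<open>X\<close> with
  denominators cleared. The hypotheses are invariant under cyclic shifts of the triangle, so one
  line stands for all three.\<close>

lemma common_point_on_line:
  assumes D: "D = cross2 (B - A) (C - A)"
    and pos: "0 < (C - A) \<bullet> (B - A)" "0 < (A - B) \<bullet> (C - B)" "0 < (B - C) \<bullet> (A - C)"
    and pqr: "0 < p * D" "0 < q * D" "0 < r * D" "p * q + q * r + r * p = 1"
    and xyz: "x = (C - A) \<bullet> (B - A) + p * D" "y = (A - B) \<bullet> (C - B) + q * D"
      "z = (B - C) \<bullet> (A - C) + r * D"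
    and X: "(x * y + y * z + z * x) *\<^sub>R X = (y * z) *\<^sub>R A + (z * x) *\<^sub>R B + (x * y) *\<^sub>R C"
  shows "X \<in> line_through (B - r *\<^sub>R perp (B - A)) (C - q *\<^sub>R perp (A - C))"
proof -
  define U V W where "U = B - A" and "V = C - A" and "W = X - A"
  define S b c k where "S = x * y + y * z + z * x" and "b = V \<bullet> V" and "c = U \<bullet> U" and "k = U \<bullet> V"
  have BB: "(A - B) \<bullet> (C - B) = c - k" and CC: "(B - C) \<bullet> (A - C) = b - k"
    and AA: "(C - A) \<bullet> (B - A) = k"
    unfolding b_def c_def k_def U_def V_def
    by (simp_all add: inner_diff_left inner_diff_right inner_commute)
  have D': "D = cross2 U V" by (simp add: D U_def V_def)
  have bc: "c * b = k\<^sup>2 + D\<^sup>2"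
    using inner_cross2_sq[of U V] by (simp add: D' b_def c_def k_def)
  have xyz': "x = k + p * D" "y = c - k + q * D" "z = b - k + r * D"
    using xyz by (simp_all add: AA BB CC)
  have pos': "0 < x" "0 < y" "0 < z" using pos pqr by (simp_all add: xyz add_pos_pos)
  have S0: "0 < S" using pos' by (simp add: S_def add_pos_pos)
  have SW: "S *\<^sub>R W = (z * x) *\<^sub>R U + (x * y) *\<^sub>R V"
    using X unfolding W_def U_def V_def S_def
    by (simp add: algebra_simps)
  \<comment> \<open>The angle condition enters here: it gives the terms in \<open>D\<^sup>2\<close>
    the value needed. The coefficients are the squared side lengths.\<close>
  have S_eq: "S = (b + c - 2 * k) * x + b * y + c * z"
    using bc pqr(4) unfolding S_def xyz' by algebra
  have UJ: "U \<bullet> perp U = 0" "V \<bullet> perp U = D" "V \<bullet> perp V = 0" "U \<bullet> perp V = - D"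
    by (simp_all add: inner_perp D' cross2_commute[of V U])
  \<comment> \<open>The two points spanning the line, seen from \<open>A\<close>; the plus sign in
    \<open>F\<close> comes from \<open>A - C = - V\<close>.\<close>
  define E F where "E = U - r *\<^sub>R perp U" and "F = V + q *\<^sub>R perp V"
  have WW: "S\<^sup>2 * (W \<bullet> W) = x\<^sup>2 * (z\<^sup>2 * c + 2 * y * z * k + y\<^sup>2 * b)"
  proof -
    have "S\<^sup>2 * (W \<bullet> W) = (S *\<^sub>R W) \<bullet> (S *\<^sub>R W)" by (simp add: power2_eq_square)
    also have "\<dots> = x\<^sup>2 * (z\<^sup>2 * c + 2 * y * z * k + y\<^sup>2 * b)"
      unfolding SW by (simp add: inner_add_left inner_add_right b_def c_def k_def
          inner_commute[of V U] power2_eq_square algebra_simps)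
    finally show ?thesis .
  qed
  have WE: "S * (W \<bullet> E) = x * (z * c + y * (b - z))"
  proof -
    have "S * (W \<bullet> E) = (S *\<^sub>R W) \<bullet> E" by simp
    also have "\<dots> = x * (z * c + y * (k - r * D))"
      unfolding SW E_def by (simp add: inner_add_left inner_diff_right UJ b_def c_def k_def
          inner_commute[of V U] algebra_simps)
    finally show ?thesis by (simp add: xyz')
  qed
  have WF: "S * (W \<bullet> F) = x * (z * (c - y) + y * b)"
  proof -
    have "S * (W \<bullet> F) = (S *\<^sub>R W) \<bullet> F" by simp
    also have "\<dots> = x * (z * (k - q * D) + y * b)"
      unfolding SW F_def by (simp add: inner_add_left inner_add_right UJ b_def c_def k_def
          inner_commute[of V U] algebra_simps)
    finally show ?thesis by (simp add: xyz')
  qed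
  have "S * (z * c + y * (b - z)) = x * (z\<^sup>2 * c + 2 * y * z * k + y\<^sup>2 * b)"
    using S_eq unfolding S_def by algebra
  then have "S\<^sup>2 * (W \<bullet> W) = S\<^sup>2 * (W \<bullet> E)" "S\<^sup>2 * (W \<bullet> W) = S\<^sup>2 * (W \<bullet> F)"
    using WW WE WF by algebra+
  \<comment> \<open>Thales: \<open>W \<bullet> W = W \<bullet> E = W \<bullet> F\<close> puts
    \<open>X\<close> on both circles whose diameters join \<open>A\<close> to the two
    points.\<close>
  then have "W \<bullet> (F - E) = 0" "W \<bullet> (W - E) = 0"
    using S0 by (simp_all add: inner_diff_right)
  moreover have "W \<noteq> 0"
  proof
    assume "W = 0"
    then have "cross2 U ((z * x) *\<^sub>R U + (x * y) *\<^sub>R V) = 0"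
      unfolding SW[symmetric] by (simp add: cross2_def)
    then show False using pos' pqr(1) by (simp add: cross2_linear flip: D')
  qed
  ultimately have par: "cross2 (F - E) (W - E) = 0"
    using orthogonal_imp_parallel by blast
  \<comment> \<open>Equality would force \<open>y = c - k + q * D\<close> to be 0, although both
    \<open>c - k\<close> and \<open>q * D\<close> are positive.\<close>
  have "E \<noteq> F"
  proof
    assume "E = F"
    then have "U \<bullet> E = U \<bullet> F" by simp
    then have "c - k = - (q * D)"
      by (simp add: E_def F_def inner_diff_right inner_add_right UJ c_def k_def)
    then show False using pos(2) pqr(2) by (simp add: BB)
  qed
  let ?P = "B - r *\<^sub>R perp (B - A)" and ?Q = "C - q *\<^sub>R perp (A - C)"
  have P: "?P = A + E" by (simp add: E_def U_def)
  have Q: "?Q = A + F" by (simp add: F_def V_def vec2_eq_iff algebra_simps)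
  show ?thesis
    using par \<open>E \<noteq> F\<close> unfolding P Q by (subst mem_line_through_iff) (simp_all add: W_def algebra_simps)
qed

theorem mainTheorem1:
  fixes A B C A\<^sub>1 A\<^sub>2 B\<^sub>1 B\<^sub>2 C\<^sub>1 C\<^sub>2 :: "real^2"
  assumes "acute_triangle A B C"
    and "rectangle_outside A B C C\<^sub>1 B\<^sub>2"
    and "rectangle_outside B C A A\<^sub>1 C\<^sub>2"
    and "rectangle_outside C A B B\<^sub>1 A\<^sub>2"
    and "angle B C\<^sub>1 C + angle C A\<^sub>1 A + angle A B\<^sub>1 B = pi"
  shows "concurrent (line_through B\<^sub>1 C\<^sub>2) (line_through C\<^sub>1 A\<^sub>2) (line_through A\<^sub>1 B\<^sub>2)"
proof -
  define D where "D = cross2 (B - A) (C - A)"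
  have DB: "D = cross2 (C - B) (A - B)" and DC: "D = cross2 (A - C) (B - C)"
    by (simp_all add: D_def cross2_rotate)
  have D0: "D \<noteq> 0"
    using assms(1) not_collinear_cross2 by (simp add: acute_triangle_def D_def)
  have pos: "0 < (C - A) \<bullet> (B - A)" "0 < (A - B) \<bullet> (C - B)" "0 < (B - C) \<bullet> (A - C)"
    using assms(1) by (auto simp: acute_triangle_def inner_commute[of "C - A"] inner_commute[of "B - C"]
        simp del: less_divide_eq_numeral1 intro!: angle_acute_imp_inner_pos)
  have ne: "A \<noteq> B" "B \<noteq> C" "C \<noteq> A" using pos by auto
  obtain p where p: "C\<^sub>1 = C - p *\<^sub>R perp (C - B)" "B\<^sub>2 = B - p *\<^sub>R perp (C - B)" "0 < p * D"
    using rectangle_outside_param[OF assms(2)] D0 unfolding DB by metis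
  obtain q where q: "A\<^sub>1 = A - q *\<^sub>R perp (A - C)" "C\<^sub>2 = C - q *\<^sub>R perp (A - C)" "0 < q * D"
    using rectangle_outside_param[OF assms(3)] D0 unfolding DC by metis
  obtain r where r: "B\<^sub>1 = B - r *\<^sub>R perp (B - A)" "A\<^sub>2 = A - r *\<^sub>R perp (B - A)" "0 < r * D"
    using rectangle_outside_param[OF assms(4)] D0 unfolding D_def by metis
  have "\<bar>p\<bar> * \<bar>q\<bar> + \<bar>q\<bar> * \<bar>r\<bar> + \<bar>r\<bar> * \<bar>p\<bar> = 1"
    using assms(5) angle_rectangle_diagonal[OF ne(2) p(1)] angle_rectangle_diagonal[OF ne(3) q(1)]
      angle_rectangle_diagonal[OF ne(1) r(1)]
    by (intro cot_sum_eq_1[OF _ sin_cos_arccos_ratio(1) sin_cos_arccos_ratio(1) sin_cos_arccos_ratio(1)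
          sin_cos_arccos_ratio(2) sin_cos_arccos_ratio(2) sin_cos_arccos_ratio(2)]) simp
  \<comment> \<open>The angles determine only absolute values, but \<open>p\<close>,
    \<open>q\<close>, \<open>r\<close> all share the sign of \<open>D\<close>.\<close>
  moreover have "\<bar>p\<bar> * \<bar>q\<bar> = p * q" "\<bar>q\<bar> * \<bar>r\<bar> = q * r" "\<bar>r\<bar> * \<bar>p\<bar> = r * p"
    using p(3) q(3) r(3) by (auto simp: zero_less_mult_iff)
  ultimately have pqr: "p * q + q * r + r * p = 1" by simp
  define x y z where "x = (C - A) \<bullet> (B - A) + p * D" and "y = (A - B) \<bullet> (C - B) + q * D"
    and "z = (B - C) \<bullet> (A - C) + r * D"
  define S where "S = x * y + y * z + z * x"
  have "0 < x" "0 < y" "0 < z" using pos p(3) q(3) r(3) by (simp_all add: x_def y_def z_def)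
  then have S0: "S \<noteq> 0" by (simp add: S_def add_pos_pos less_imp_neq[symmetric])
  define X where "X = (1 / S) *\<^sub>R ((y * z) *\<^sub>R A + (z * x) *\<^sub>R B + (x * y) *\<^sub>R C)"
  have X: "S *\<^sub>R X = (y * z) *\<^sub>R A + (z * x) *\<^sub>R B + (x * y) *\<^sub>R C"
    using S0 by (simp add: X_def)
  \<comment> \<open>\<open>X\<close> and \<open>S\<close> are unchanged by the cyclic shift, so the
    same point serves in the two shifted instances.\<close>
  have "X \<in> line_through B\<^sub>1 C\<^sub>2"
    unfolding r(1) q(2) using pos p(3) q(3) r(3) pqr X
    by (intro common_point_on_line[OF D_def _ _ _ _ _ _ _ x_def y_def z_def])
      (simp_all add: S_def algebra_simps)
  moreover have "X \<in> line_through C\<^sub>1 A\<^sub>2"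
    unfolding p(1) r(2) using pos p(3) q(3) r(3) pqr X
    by (intro common_point_on_line[OF DB _ _ _ _ _ _ _ y_def z_def x_def])
      (simp_all add: S_def algebra_simps)
  moreover have "X \<in> line_through A\<^sub>1 B\<^sub>2"
    unfolding q(1) p(2) using pos p(3) q(3) r(3) pqr X
    by (intro common_point_on_line[OF DC _ _ _ _ _ _ _ z_def x_def y_def])
      (simp_all add: S_def algebra_simps)
  ultimately show ?thesis unfolding concurrent_def by blast
qed

end
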